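(* Let $w_{1},w_{2},w_{3}$ be any odd positive integers and $n\ge 0$ an integer. Then for all $y_1,y_2$ the following six expressions are equal: \begin{align*} &\sum_{k+l+m=n}\binom{n}{k,l,m}E_{k}(w_{1}y_{1})E_{l}(w_{2}y_{2})T_{m}(w_{3}-1)w_{1}^{l+m}w_{2}^{k+m}w_{3}^{k+l}\\ =&\sum_{k+l+m=n}\binom{n}{k,l,m}E_{k}(w_{1}y_{1})E_{l}(w_{3}y_{2})T_{m}(w_{2}-1)w_{1}^{l+m}w_{3}^{k+m}w_{2}^{k+l}\\ =&\sum_{k+l+m=n}\binom{n}{k,l,m}E_{k}(w_{2}y_{1})E_{l}(w_{1}y_{2})T_{m}(w_{3}-1)w_{2}^{l+m}w_{1}^{k+m}w_{3}^{k+l}\\ =&\sum_{k+l+m=n}\binom{n}{k,l,m}E_{k}(w_{2}y_{1})E_{l}(w_{3}y_{2})T_{m}(w_{1}-1)w_{2}^{l+m}w_{3}^{k+m}w_{1}^{k+l}\\ =&\sum_{k+l+m=n}\binom{n}{k,l,m}E_{k}(w_{3}y_{1})E_{l}(w_{2}y_{2})T_{m}(w_{1}-1)w_{3}^{l+m}w_{2}^{k+m}w_{1}^{k+l}\\ =&\sum_{k+l+m=n}\binom{n}{k,l,m}E_{k}(w_{3}y_{1})E_{l}(w_{1}y_{2})T_{m}(w_{2}-1)w_{3}^{l+m}w_{1}^{k+m}w_{2}^{k+l}. \end{align*}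
   Context: The Euler polynomials $E_n(x)$ are defined by $\frac{2}{e^{t}+1}e^{xt}=\sum_{n=0}^{\infty}E_{n}(x)\frac{t^{n}}{n!}$. For integers $k,N\ge0$, $T_{k}(N)=\sum_{i=0}^{N}(-1)^{i}i^{k}$ (alternating power sum), with the convention $0^0=1$. Sums $\sum_{k+l+m=n}$ run over all nonnegative integers $k,l,m$ with $k+l+m=n$, and $\binom{n}{k,l,m}=\frac{n!}{k!\,l!\,m!}$. *)

theory Defs
  imports "HOL-Computational_Algebra.Formal_Power_Series"
begin

definition euler_polynomial :: "nat \<Rightarrow> 'a :: field_char_0 \<Rightarrow> 'a" where
  "euler_polynomial n x = fact n * fps_nth (2 / (fps_exp 1 + 1) * fps_exp x) n"

lemma euler_polynomial_generating_function:
  fixes x :: "'a :: field_char_0"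
  shows "2 / (fps_exp 1 + 1) * fps_exp x = Abs_fps (\<lambda>n. euler_polynomial n x / fact n)"
  by (rule fps_ext) (simp add: euler_polynomial_def)

definition alt_power_sum :: "nat \<Rightarrow> nat \<Rightarrow> 'a :: comm_ring_1" where
  "alt_power_sum k N = (\<Sum>i=0..N. (-1) ^ i * of_nat i ^ k)"

definition trinomial :: "nat \<Rightarrow> nat \<Rightarrow> nat \<Rightarrow> nat \<Rightarrow> 'a :: field_char_0" where
  "trinomial n k l m = fact n / (fact k * fact l * fact m)"

end

theory Submission
  imports Defs
begin

text \<open>
  Writing \<open>W = w1 w2 w3\<close>, the first expression is \<open>n!\<close> times the \<open>n\<close>-th coefficient of
  the product of the generating functions \<open>2 e^(W y1 t) / (e^(w2 w3 t) + 1)\<close>,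
  \<open>2 e^(W y2 t) / (e^(w1 w3 t) + 1)\<close> and \<open>\<Sum>i<w3. (-1)^i e^(i w1 w2 t)\<close>. As \<open>w3\<close> is odd, the
  last factor is \<open>(e^(W t) + 1) / (e^(w1 w2 t) + 1)\<close>, so the product is symmetric
  in \<open>w1, w2, w3\<close>.
\<close>

lemma fps_mult3_nth:
  fixes f g h :: "'a :: comm_semiring_1 fps"
  shows "fps_nth (f * g * h) n =
    (\<Sum>(k, l, m) \<in> {(k, l, m). k + l + m = n}. fps_nth f k * fps_nth g l * fps_nth h m)"
proof -
  have "fps_nth (f * g * h) n =
      (\<Sum>i=0..n. \<Sum>k=0..i. fps_nth f k * fps_nth g (i - k) * fps_nth h (n - i))"
    by (simp add: fps_mult_nth sum_distrib_right)
  also have "\<dots> = (\<Sum>(i, k) \<in> Sigma {0..n} (\<lambda>i. {0..i}).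
      fps_nth f k * fps_nth g (i - k) * fps_nth h (n - i))"
    by (rule sum.Sigma) auto
  also have "\<dots> =
      (\<Sum>(k, l, m) \<in> {(k, l, m). k + l + m = n}. fps_nth f k * fps_nth g l * fps_nth h m)"
    \<comment> \<open>The nested convolution is indexed by the partial sum \<open>i = k + l\<close>
      and by \<open>k\<close>.\<close>
    by (rule sum.reindex_bij_witness[where
          i = "\<lambda>(k, l, m). (k + l, k)" and j = "\<lambda>(i, k). (k, i - k, n - i)"]) auto
  finally show ?thesis .
qed

lemma fps_exp_plus_1_nonzero: "fps_exp a + 1 \<noteq> (0 :: 'a :: field_char_0 fps)"
proof
  assume "fps_exp a + 1 = 0"
  then have "fps_nth (fps_exp a + 1) 0 = 0" by simp
  then show False by simp
qed

text \<open>The series \<open>2 * fps_exp (a * x) / (fps_exp a + 1)\<close>, given by its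
  coefficients so that those of a product can be read off.\<close>

definition euler_fps :: "'a :: field_char_0 \<Rightarrow> 'a \<Rightarrow> 'a fps" where
  "euler_fps a x = Abs_fps (\<lambda>n. a ^ n * (euler_polynomial n x / fact n))"

text \<open>The alternating sum of \<open>fps_exp (of_nat i * a)\<close> over
  \<open>i \<le> N\<close>, expanded in powers of the variable.\<close>

definition alt_power_sum_fps :: "'a :: field_char_0 \<Rightarrow> nat \<Rightarrow> 'a fps" where
  "alt_power_sum_fps a N = Abs_fps (\<lambda>n. a ^ n * (alt_power_sum n N / fact n))"

text \<open>Scaling the variable by \<open>a\<close> in the generating function of the Euler
  polynomials gives this; with the denominator cleared, later arguments need no division.\<close>

lemma fps_exp_plus_1_mult_euler_fps:
  fixes a x :: "'a :: field_char_0"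
  shows "(fps_exp a + 1) * euler_fps a x = 2 * fps_exp (a * x)"
proof -
  let ?L = "fps_const a * fps_X"
  define E where "E = 2 / (fps_exp 1 + 1) * fps_exp x"
  have "(fps_exp 1 + 1) * E = 2 * fps_exp x"
    \<comment> \<open>The constant coefficient of \<open>fps_exp 1 + 1\<close> is 2, nonzero in
      characteristic 0, so the division is by a unit.\<close>
    unfolding E_def by (simp add: fps_divide_unit inverse_mult_eq_1' mult_ac)
  then have "fps_compose ((fps_exp 1 + 1) * E) ?L = fps_compose (fps_const 2 * fps_exp x) ?L"
    by (simp add: numeral_fps_const)
  then have "(fps_exp a + 1) * fps_compose E ?L = 2 * fps_exp (x * a)"
    by (simp add: fps_compose_mult_distrib fps_compose_add_distrib fps_exp_compose_linear
        numeral_fps_const)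
  moreover have "fps_compose E ?L = euler_fps a x"
    unfolding E_def euler_polynomial_generating_function
    by (simp add: fps_eq_iff fps_nth_compose_linear euler_fps_def)
  ultimately show ?thesis by (simp add: mult.commute)
qed

text \<open>A finite geometric series with ratio \<open>- fps_exp a\<close>; odd \<open>w\<close>
  turns \<open>1 - (- fps_exp a) ^ w\<close> into a sum.\<close>

lemma fps_exp_plus_1_mult_alt_power_sum_fps:
  fixes a :: "'a :: field_char_0"
  assumes "odd w"
  shows "(fps_exp a + 1) * alt_power_sum_fps a (w - 1) = fps_exp (of_nat w * a) + 1"
proof -
  \<comment> \<open>Oddness excludes \<open>w = 0\<close>, where truncated subtraction would leave
    \<open>{0..0}\<close> instead of the empty range.\<close>
  have w: "{0..w - Suc 0} = {..<w}" using assms by (auto elim: oddE)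
  have "alt_power_sum_fps a (w - 1) = (\<Sum>i<w. (- fps_exp a) ^ i)"
  proof (rule fps_ext)
    fix n
    have "fps_nth (\<Sum>i<w. (- fps_exp a) ^ i) n =
        (\<Sum>i<w. (-1) ^ i * ((of_nat i * a) ^ n / fact n))"
      unfolding fps_sum_nth
    proof (rule sum.cong[OF refl])
      fix i
      have "(- fps_exp a) ^ i = fps_const ((-1) ^ i) * fps_exp (of_nat i * a)"
        by (subst power_minus)
          (simp add: fps_exp_power_mult fps_const_power[symmetric] flip: fps_const_neg)
      then show "fps_nth ((- fps_exp a) ^ i) n = (-1) ^ i * ((of_nat i * a) ^ n / fact n)"
        by simp
    qed
    then show "fps_nth (alt_power_sum_fps a (w - 1)) n = fps_nth (\<Sum>i<w. (- fps_exp a) ^ i) n"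
      by (simp add: alt_power_sum_fps_def alt_power_sum_def w sum_distrib_left sum_divide_distrib
          power_mult_distrib mult_ac)
  qed
  then have "(fps_exp a + 1) * alt_power_sum_fps a (w - 1) = 1 - (- fps_exp a) ^ w"
    by (simp add: one_diff_power_eq add.commute)
  then show ?thesis using assms by (simp add: fps_exp_power_mult add.commute)
qed

text \<open>The six expressions are its values at the permutations of the three weights, with
  \<open>x\<close> and \<open>y\<close> fixed.\<close>

definition euler_trinomial_sum :: "nat \<Rightarrow> nat \<Rightarrow> nat \<Rightarrow> nat \<Rightarrow> 'a \<Rightarrow> 'a \<Rightarrow> 'a :: field_char_0" where
  "euler_trinomial_sum n u v w x y = (\<Sum>(k, l, m) \<in> {(k, l, m). k + l + m = n}.
     trinomial n k l m * euler_polynomial k (of_nat u * x) * euler_polynomial l (of_nat v * y)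
     * alt_power_sum m (w - 1) * of_nat u ^ (l + m) * of_nat v ^ (k + m) * of_nat w ^ (k + l))"

definition euler_product_fps :: "nat \<Rightarrow> nat \<Rightarrow> nat \<Rightarrow> 'a \<Rightarrow> 'a \<Rightarrow> 'a :: field_char_0 fps" where
  "euler_product_fps u v w x y = euler_fps (of_nat (v * w)) (of_nat u * x)
     * euler_fps (of_nat (u * w)) (of_nat v * y) * alt_power_sum_fps (of_nat (u * v)) (w - 1)"

text \<open>The powers of the weights regroup as \<open>(v * w) ^ k\<close>,
  \<open>(u * w) ^ l\<close> and \<open>(u * v) ^ m\<close>, one for each factor of the
  product.\<close>

lemma euler_trinomial_sum_eq_nth:
  fixes x y :: "'a :: field_char_0"
  shows "euler_trinomial_sum n u v w x y = fact n * fps_nth (euler_product_fps u v w x y) n"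
  unfolding euler_trinomial_sum_def euler_product_fps_def fps_mult3_nth sum_distrib_left
  by (rule sum.cong) (auto simp: trinomial_def euler_fps_def alt_power_sum_fps_def power_add
      power_mult_distrib field_simps)

text \<open>Each denominator cancels against its own factor. Both Euler exponents acquire the same
  coefficient \<open>u * v * w\<close>, which makes the right side symmetric in the weights.\<close>

lemma euler_product_fps_closed_form:
  fixes x y :: "'a :: field_char_0"
  assumes "odd w"
  shows "(fps_exp (of_nat (v * w)) + 1) * (fps_exp (of_nat (u * w)) + 1)
      * (fps_exp (of_nat (u * v)) + 1) * euler_product_fps u v w x y
    = 4 * fps_exp (of_nat (u * v * w) * (x + y)) * (fps_exp (of_nat (u * v * w)) + 1)"
proof -
  have "(fps_exp (of_nat (v * w)) + 1) * (fps_exp (of_nat (u * w)) + 1)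
      * (fps_exp (of_nat (u * v)) + 1) * euler_product_fps u v w x y
    = ((fps_exp (of_nat (v * w)) + 1) * euler_fps (of_nat (v * w)) (of_nat u * x))
      * ((fps_exp (of_nat (u * w)) + 1) * euler_fps (of_nat (u * w)) (of_nat v * y))
      * ((fps_exp (of_nat (u * v)) + 1) * alt_power_sum_fps (of_nat (u * v)) (w - 1))"
    unfolding euler_product_fps_def by (simp only: mult_ac)
  also have "\<dots> = (2 * fps_exp (of_nat (v * w) * (of_nat u * x)))
      * (2 * fps_exp (of_nat (u * w) * (of_nat v * y)))
      * (fps_exp (of_nat w * of_nat (u * v)) + 1)"
    by (simp only: fps_exp_plus_1_mult_euler_fps fps_exp_plus_1_mult_alt_power_sum_fps[OF assms])
  also have "\<dots> = 4 * fps_exp (of_nat (u * v * w) * (x + y)) * (fps_exp (of_nat (u * v * w)) + 1)"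
    by (simp add: distrib_left fps_exp_add_mult mult_ac)
  finally show ?thesis .
qed

text \<open>Swapping \<open>u\<close> and \<open>v\<close> only permutes the factors of
  \<open>?D\<close> and keeps the closed form; \<open>?D\<close> is nonzero and cancels in the
  integral domain of power series.\<close>

lemma euler_product_fps_commute:
  fixes x y :: "'a :: field_char_0"
  assumes "odd w"
  shows "euler_product_fps u v w x y = euler_product_fps v u w x y"
proof -
  let ?D = "(fps_exp (of_nat (v * w)) + 1) * (fps_exp (of_nat (u * w)) + 1)
      * (fps_exp (of_nat (u * v)) + 1) :: 'a fps"
  have "?D * euler_product_fps u v w x y = ?D * euler_product_fps v u w x y"
    using euler_product_fps_closed_form[OF assms, of v u x y]
      euler_product_fps_closed_form[OF assms, of u v x y]
    by (simp only: mult_ac)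
  then show ?thesis by (simp add: fps_exp_plus_1_nonzero del: of_nat_mult)
qed

text \<open>The same cancellation, with \<open>w\<close> in the last slot on one side and
  \<open>u\<close> on the other, so the closed form is used with each of them odd.\<close>

lemma euler_product_fps_rotate:
  fixes x y :: "'a :: field_char_0"
  assumes "odd u" "odd w"
  shows "euler_product_fps u v w x y = euler_product_fps v w u x y"
proof -
  let ?D = "(fps_exp (of_nat (v * w)) + 1) * (fps_exp (of_nat (u * w)) + 1)
      * (fps_exp (of_nat (u * v)) + 1) :: 'a fps"
  have "?D * euler_product_fps u v w x y = ?D * euler_product_fps v w u x y"
    using euler_product_fps_closed_form[OF assms(1), of w v x y]
      euler_product_fps_closed_form[OF assms(2), of v u x y]
    by (simp only: mult_ac)
  then show ?thesis by (simp add: fps_exp_plus_1_nonzero del: of_nat_mult)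
qed

theorem theorem2:
  fixes w1 w2 w3 n :: nat and y1 y2 :: "'a :: field_char_0"
  assumes "w1 > 0" "odd w1" and "w2 > 0" "odd w2" and "w3 > 0" "odd w3"
  shows
    "  (\<Sum>(k, l, m) \<in> {(k, l, m). k + l + m = n}.
           trinomial n k l m * euler_polynomial k (of_nat w1 * y1) * euler_polynomial l (of_nat w2 * y2)
           * alt_power_sum m (w3 - 1) * of_nat w1 ^ (l + m) * of_nat w2 ^ (k + m) * of_nat w3 ^ (k + l))
       = (\<Sum>(k, l, m) \<in> {(k, l, m). k + l + m = n}.
           trinomial n k l m * euler_polynomial k (of_nat w1 * y1) * euler_polynomial l (of_nat w3 * y2)
           * alt_power_sum m (w2 - 1) * of_nat w1 ^ (l + m) * of_nat w3 ^ (k + m) * of_nat w2 ^ (k + l))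
     \<and> (\<Sum>(k, l, m) \<in> {(k, l, m). k + l + m = n}.
           trinomial n k l m * euler_polynomial k (of_nat w1 * y1) * euler_polynomial l (of_nat w3 * y2)
           * alt_power_sum m (w2 - 1) * of_nat w1 ^ (l + m) * of_nat w3 ^ (k + m) * of_nat w2 ^ (k + l))
       = (\<Sum>(k, l, m) \<in> {(k, l, m). k + l + m = n}.
           trinomial n k l m * euler_polynomial k (of_nat w2 * y1) * euler_polynomial l (of_nat w1 * y2)
           * alt_power_sum m (w3 - 1) * of_nat w2 ^ (l + m) * of_nat w1 ^ (k + m) * of_nat w3 ^ (k + l))
     \<and> (\<Sum>(k, l, m) \<in> {(k, l, m). k + l + m = n}.
           trinomial n k l m * euler_polynomial k (of_nat w2 * y1) * euler_polynomial l (of_nat w1 * y2)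
           * alt_power_sum m (w3 - 1) * of_nat w2 ^ (l + m) * of_nat w1 ^ (k + m) * of_nat w3 ^ (k + l))
       = (\<Sum>(k, l, m) \<in> {(k, l, m). k + l + m = n}.
           trinomial n k l m * euler_polynomial k (of_nat w2 * y1) * euler_polynomial l (of_nat w3 * y2)
           * alt_power_sum m (w1 - 1) * of_nat w2 ^ (l + m) * of_nat w3 ^ (k + m) * of_nat w1 ^ (k + l))
     \<and> (\<Sum>(k, l, m) \<in> {(k, l, m). k + l + m = n}.
           trinomial n k l m * euler_polynomial k (of_nat w2 * y1) * euler_polynomial l (of_nat w3 * y2)
           * alt_power_sum m (w1 - 1) * of_nat w2 ^ (l + m) * of_nat w3 ^ (k + m) * of_nat w1 ^ (k + l))
       = (\<Sum>(k, l, m) \<in> {(k, l, m). k + l + m = n}.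
           trinomial n k l m * euler_polynomial k (of_nat w3 * y1) * euler_polynomial l (of_nat w2 * y2)
           * alt_power_sum m (w1 - 1) * of_nat w3 ^ (l + m) * of_nat w2 ^ (k + m) * of_nat w1 ^ (k + l))
     \<and> (\<Sum>(k, l, m) \<in> {(k, l, m). k + l + m = n}.
           trinomial n k l m * euler_polynomial k (of_nat w3 * y1) * euler_polynomial l (of_nat w2 * y2)
           * alt_power_sum m (w1 - 1) * of_nat w3 ^ (l + m) * of_nat w2 ^ (k + m) * of_nat w1 ^ (k + l))
       = (\<Sum>(k, l, m) \<in> {(k, l, m). k + l + m = n}.
           trinomial n k l m * euler_polynomial k (of_nat w3 * y1) * euler_polynomial l (of_nat w1 * y2)
           * alt_power_sum m (w2 - 1) * of_nat w3 ^ (l + m) * of_nat w1 ^ (k + m) * of_nat w2 ^ (k + l))"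
  \<comment> \<open>The swap of the first two weights and the rotation generate all permutations of
    the three odd weights.\<close>
  unfolding euler_trinomial_sum_def[symmetric] euler_trinomial_sum_eq_nth
  using assms by (metis euler_product_fps_commute euler_product_fps_rotate)

end
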